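(* Let $d\geq 1$ and let $(F_n)$ be a Følner sequence of $\mathbb{Z}^d$. Assume that $\mu_{F_n,\mathsf{cop}}(\{\omega : \omega(0,\dots,0)=1\})$ converges to $1/\zeta(d)$ as $n\to\infty$. Then $\mu_{F_n,\mathsf{cop}}$ converges weakly to $\mu_{\infty,\mathsf{cop}}$.
   Context: A sequence $(F_n)$ of finite nonempty subsets of $\mathbb{Z}^d$ is a Følner sequence if for every $y\in\mathbb{Z}^d$, $|F_n\Delta(F_n+y)|=o(|F_n|)$. $\zeta(s)=\sum_{n\ge1}n^{-s}\in[1,\infty]$ for $s\ge 1$, so $\zeta(1)=\infty$ and $1/\zeta(1)=0$. $\Omega_{\{0,1\}}:=\{0,1\}^{\mathbb{Z}^d}$ with the product topology; probability measures on it carry the weak topology. $\mathsf{cop}\in\Omega_{\{0,1\}}$ is defined by $\mathsf{cop}(x)=1$ if $\gcd(x_1,\dots,x_d)=1$ and $\mathsf{cop}(x)=0$ otherwise. For a nonempty finite $F\subset\mathbb{Z}^d$, $\mu_{F,\mathsf{cop}}$ is the distribution of the random element $x\mapsto \mathsf{cop}(x+Y)$, where $Y$ is uniformly distributed in $F$. Definition of $\mu_{\infty,\mathsf{cop}}$: independently for every prime $p$, let $\mathcal{W}_p$ be a uniformly chosen coset of $p\mathbb{Z}^d$ in $\mathbb{Z}^d$ (among the $p^d$ cosets). Then $\mu_{\infty,\mathsf{cop}}$ is the distribution of the indicator function of $\mathbb{Z}^d\setminus\bigcup_p\mathcal{W}_p$, i.e. of $x\mapsto\min_p \mathbf{1}_{x\notin\mathcal{W}_p}$.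 *)

theory Defs
  imports
    "HOL-Probability.Probability"
    "HOL-Library.Landau_Symbols"
    "HOL-Computational_Algebra.Primes"
begin

text \<open>
  \<open>\<int>\<^sup>d\<close> is the type \<open>int ^ 'd\<close>, with \<open>d = CARD('d) \<ge> 1\<close>. Configurations in \<open>{0,1}\<^sup>\<int>\<^sup>d\<close> are
  functions \<open>int ^ 'd \<Rightarrow> bool\<close>, with \<open>True\<close> for 1 and \<open>False\<close> for 0; the topology on \<open>bool\<close> is
  discrete and the topology on functions is the product topology.
\<close>

definition folner_seq :: "(nat \<Rightarrow> (int ^ 'd) set) \<Rightarrow> bool" where
  "folner_seq F \<longleftrightarrow>
     (\<forall>n. finite (F n) \<and> F n \<noteq> {}) \<and>
     (\<forall>y. (\<lambda>n. real (card (sym_diff (F n) ((\<lambda>x. x + y) ` F n)))) \<in> o(\<lambda>n. real (card (F n))))"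

definition zeta :: "real \<Rightarrow> ennreal" where
  "zeta s = (\<Sum>n. ennreal (real (Suc n) powr (- s)))"

definition cop :: "int ^ 'd \<Rightarrow> bool" where
  "cop x \<longleftrightarrow> Gcd (range (\<lambda>i. x $ i)) = 1"

definition mu_cop :: "(int ^ 'd) set \<Rightarrow> (int ^ 'd \<Rightarrow> bool) measure" where
  "mu_cop F = distr (measure_pmf (pmf_of_set F)) borel (\<lambda>y x. cop (x + y))"

definition cosets_mult :: "nat \<Rightarrow> (int ^ 'd) set set" where
  "cosets_mult p = range (\<lambda>a. (\<lambda>z. a + z) ` range (\<lambda>z. int p *s z))"

definition random_cosets :: "(nat \<Rightarrow> (int ^ 'd) set) measure" where
  "random_cosets = (\<Pi>\<^sub>M p\<in>{p. prime p}. measure_pmf (pmf_of_set (cosets_mult p)))"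

definition mu_inf_cop :: "(int ^ 'd \<Rightarrow> bool) measure" where
  "mu_inf_cop = distr random_cosets borel (\<lambda>W x. x \<notin> (\<Union>p\<in>{p. prime p}. W p))"

text \<open>The library's \<open>weak_conv_m\<close> only covers measures on the real line.\<close>

definition weakly_converges ::
  "(nat \<Rightarrow> 'a :: topological_space measure) \<Rightarrow> 'a measure \<Rightarrow> bool" where
  "weakly_converges M N \<longleftrightarrow>
     (\<forall>f :: 'a \<Rightarrow> real. continuous_on UNIV f \<longrightarrow> bounded (range f) \<longrightarrow>
        (\<lambda>n. \<integral>\<omega>. f \<omega> \<partial>M n) \<longlonglongrightarrow> (\<integral>\<omega>. f \<omega> \<partial>N))"

text \<open>
  \<open>pmf_of_set\<close> and \<open>distr\<close> have their intended meaning only for finite nonempty sets and for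
  measurable maps, respectively; the following facts show that this is the case above.
\<close>

instance bool :: second_countable_topology
proof
  have "open = generate_topology (UNIV :: bool set set)"
    by (simp add: fun_eq_iff Topological_Spaces.open_discrete generate_topology.Basis)
  then show "\<exists>B :: bool set set. countable B \<and> open = generate_topology B"
    by (intro exI[of _ UNIV]) auto
qed

lemma card_cosets_mult:
  assumes "p > 0"
  shows "card (cosets_mult p :: (int ^ 'd) set set) = p ^ CARD('d)"
proof -
  let ?R = "{a :: int ^ 'd. \<forall>i. a $ i \<in> {0..<int p}}"
  let ?c = "\<lambda>a :: int ^ 'd. (\<lambda>z. a + z) ` range (\<lambda>z. int p *s z)"
  have mem: "b \<in> ?c a \<longleftrightarrow> (\<forall>i. a $ i mod int p = b $ i mod int p)" for a b :: "int ^ 'd"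
  proof
    assume "b \<in> ?c a" then show "\<forall>i. a $ i mod int p = b $ i mod int p" by auto
  next
    assume *: "\<forall>i. a $ i mod int p = b $ i mod int p"
    have "b = a + int p *s (\<chi> i. (b $ i - a $ i) div int p)"
      using * by (simp add: vec_eq_iff) (metis add.commute diff_add_cancel dvd_mult_div_cancel mod_eq_dvd_iff)
    then show "b \<in> ?c a" by blast
  qed
  have inj: "inj_on ?c ?R"
  proof (rule inj_onI)
    fix a b assume "a \<in> ?R" "b \<in> ?R" "?c a = ?c b"
    moreover have "b \<in> ?c b" by (simp only: mem) simp
    ultimately have "\<forall>i. a $ i mod int p = b $ i mod int p" by (metis mem)
    with \<open>a \<in> ?R\<close> \<open>b \<in> ?R\<close> show "a = b" by (simp add: vec_eq_iff)
  qed
  have "cosets_mult p = ?c ` ?R"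
  proof -
    have "?c a = ?c (\<chi> i. a $ i mod int p)" for a
      by (rule set_eqI) (simp only: mem, simp)
    moreover have "(\<chi> i. a $ i mod int p) \<in> ?R" for a :: "int ^ 'd" using assms by simp
    ultimately show ?thesis unfolding cosets_mult_def by blast
  qed
  then have "card (cosets_mult p :: (int ^ 'd) set set) = card ?R"
    using card_image[OF inj] by simp
  also have "?R = vec_lambda ` (UNIV \<rightarrow>\<^sub>E {0..<int p})"
  proof (intro set_eqI iffI)
    fix a :: "int ^ 'd" assume "a \<in> ?R"
    then show "a \<in> vec_lambda ` (UNIV \<rightarrow>\<^sub>E {0..<int p})"
      by (intro image_eqI[of _ _ "vec_nth a"]) auto
  qed auto
  also have "card \<dots> = p ^ CARD('d)"
    by (subst card_image) (auto simp: inj_on_def vec_lambda_inject card_PiE)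
  finally show ?thesis .
qed

lemma finite_cosets_mult: "p > 0 \<Longrightarrow> finite (cosets_mult p :: (int ^ 'd) set set)"
  by (rule card_ge_0_finite) (simp add: card_cosets_mult)

lemma cosets_mult_nonempty: "cosets_mult p \<noteq> {}"
  by (auto simp: cosets_mult_def)

lemma sets_borel_coordinate: "{\<omega> :: int ^ 'd \<Rightarrow> bool. \<omega> x} \<in> sets borel"
proof -
  have "open ((\<lambda>\<omega> :: int ^ 'd \<Rightarrow> bool. \<omega> x) -` {True})"
    by (intro open_vimage continuous_on_product_coordinates Topological_Spaces.open_discrete)
  then show ?thesis by (simp add: vimage_def)
qed

lemma measurable_mu_cop: "(\<lambda>y x. cop (x + y)) \<in> measure_pmf (pmf_of_set F) \<rightarrow>\<^sub>M borel"
  by simp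

lemma measurable_mu_inf_cop:
  "(\<lambda>W x. x \<notin> (\<Union>p\<in>{p. prime p}. W p)) \<in> (random_cosets :: (nat \<Rightarrow> (int ^ 'd) set) measure) \<rightarrow>\<^sub>M borel"
proof (rule measurable_coordinatewise_then_product)
  fix x :: "int ^ 'd"
  have "(\<lambda>W. x \<in> W p) \<in> random_cosets \<rightarrow>\<^sub>M count_space UNIV" if "prime p" for p
    unfolding random_cosets_def
    by (rule measurable_compose[OF measurable_component_singleton]) (use that in auto)
  then have *: "(\<lambda>W. \<forall>p\<in>{p. prime p}. x \<notin> W p) \<in> random_cosets \<rightarrow>\<^sub>M count_space UNIV"
    by (intro pred_intros_countable_bounded pred_intros_logic) auto
  have "(\<lambda>W. \<forall>p\<in>{p. prime p}. x \<notin> W p) \<in> borel_measurable random_cosets"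
    by (rule measurable_compose[OF * borel_measurable_count_space[of "\<lambda>b. b"]])
  then show "(\<lambda>W. x \<notin> (\<Union>p\<in>{p. prime p}. W p)) \<in> borel_measurable random_cosets"
    by simp
qed

end

theory Submission
  imports Defs "HOL-Number_Theory.Cong"
begin

text \<open>
  For a set \<open>P\<close> of primes call a point \<open>P\<close>-rough if no prime of \<open>P\<close> divides all its coordinates, so
  that \<open>cop\<close> is roughness for the set of all primes. For a finite \<open>P\<close> the roughness of the points
  \<open>x + y\<close>, for all \<open>x\<close> at once, is a function of the cosets \<open>- y + p\<int>\<^sup>d\<close> with \<open>p \<in> P\<close>: the point
  \<open>x + y\<close> is rough iff \<open>x\<close> avoids all of them. A Folner sequence gives asymptotically equal weight to
  the translates of a set. By the Chinese remainder theorem each choice of one coset per \<open>p \<in> P\<close> is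
  realised by some \<open>y\<close>, so the sets of \<open>y\<close> belonging to different choices are translates of each other.
  Hence for \<open>y\<close> uniform in \<open>F n\<close> the cosets become independent and uniform, and the \<open>P\<close>-rough
  configuration seen from \<open>y\<close> converges to the one given by \<open>random_cosets\<close>
  (\<open>folner_rough_configuration\<close>).

  Now let \<open>P\<close> be the set of primes up to \<open>k\<close>. On the side of the random cosets, letting
  \<open>k \<rightarrow> \<infinity>\<close> is dominated convergence (\<open>integral_unsieved_tendsto\<close>). On the side of \<open>F n\<close> the two
  limits have to be exchanged, and this is where the density assumption enters. The coprime points
  are among the rough ones, which have density \<open>\<Prod>p\<le>k. (1 - p\<^sup>-\<^sup>d)\<close>; so the rough points that are not
  coprime have density \<open>\<Prod>p\<le>k. (1 - p\<^sup>-\<^sup>d) - 1/\<zeta>(d)\<close>, which is small for large \<open>k\<close> by the easy half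
  of the Euler product (\<open>prod_primes_upto_le_zeta\<close>). The same holds for each translate of this set,
  and by compactness a continuous function on the configuration space depends, up to a small
  error, on finitely many coordinates only (\<open>continuous_finitely_many_coordinates\<close>). A union bound
  over these coordinates finishes the proof.
\<close>

section \<open>Densities along a Folner sequence\<close>

text \<open>
  Counting \<open>Q\<close> on \<open>F n\<close> after a shift is counting \<open>Q\<close> on the shifted set, which differs from \<open>F n\<close> by
  a negligible number of points.
\<close>

lemma folner_density_shift:
  fixes F :: "nat \<Rightarrow> (int ^ 'd) set"
  assumes "folner_seq F"
  shows "(\<lambda>n. real (card {y \<in> F n. Q (y + v)}) / card (F n) - real (card {y \<in> F n. Q y}) / card (F n)) \<longlonglongrightarrow> 0"
proof (rule tendsto_rabs_zero_cancel, rule tendsto_sandwich[OF _ _ tendsto_const])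
  let ?S = "\<lambda>n. sym_diff (F n) ((\<lambda>x. x + v) ` F n)"
  have fin: "finite (F n)" for n using assms by (auto simp: folner_seq_def)
  show "(\<lambda>n. real (card (?S n)) / real (card (F n))) \<longlonglongrightarrow> 0"
    using assms by (auto simp: folner_seq_def intro: smalloD_tendsto)
  have "\<bar>real (card {y \<in> F n. Q (y + v)}) - real (card {y \<in> F n. Q y})\<bar> \<le> card (?S n)" for n
  proof -
    let ?B = "{z \<in> (\<lambda>x. x + v) ` F n. Q z}" and ?A = "{y \<in> F n. Q y}"
    have "?B = (\<lambda>x. x + v) ` {y \<in> F n. Q (y + v)}" by auto
    then have B: "card ?B = card {y \<in> F n. Q (y + v)}" by (simp add: card_image)
    have "card ?B \<le> card (?A \<union> ?S n)" "card ?A \<le> card (?B \<union> ?S n)"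
      by (rule card_mono; use fin in auto)+
    then have "card ?B \<le> card ?A + card (?S n)" "card ?A \<le> card ?B + card (?S n)"
      using card_Un_le[of ?A "?S n"] card_Un_le[of ?B "?S n"] by linarith+
    then show ?thesis unfolding B by linarith
  qed
  then show "\<forall>\<^sub>F n in sequentially. \<bar>real (card {y \<in> F n. Q (y + v)}) / card (F n) - real (card {y \<in> F n. Q y}) / card (F n)\<bar>
      \<le> real (card (?S n)) / real (card (F n))"
    by (intro always_eventually allI) (simp add: diff_divide_distrib[symmetric] divide_right_mono)
qed auto

text \<open>
  If the level sets of \<open>c\<close> are translates of each other, their densities differ by \<open>o(1)\<close>; as the
  densities sum to 1, each of them tends to \<open>1 / card T\<close>.
\<close>

lemma folner_equidistributed:
  fixes F :: "nat \<Rightarrow> (int ^ 'd) set" and c :: "int ^ 'd \<Rightarrow> 'c" and h :: "'c \<Rightarrow> real"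
  assumes F: "folner_seq F" and T: "finite T" "\<And>y. c y \<in> T"
    and translate: "\<And>s t. s \<in> T \<Longrightarrow> t \<in> T \<Longrightarrow> \<exists>v. \<forall>y. c y = s \<longleftrightarrow> c (y + v) = t"
  shows "(\<lambda>n. (\<Sum>y\<in>F n. h (c y)) / card (F n)) \<longlonglongrightarrow> (\<Sum>t\<in>T. h t) / card T"
proof -
  define D where "D n t = real (card {y \<in> F n. c y = t}) / card (F n)" for n t
  have fin: "finite (F n)" "F n \<noteq> {}" for n using F by (auto simp: folner_seq_def)
  have T0: "T \<noteq> {}" using T by auto
  have sum_D: "(\<Sum>y\<in>F n. g (c y)) / card (F n) = (\<Sum>t\<in>T. g t * D n t)" for g :: "'c \<Rightarrow> real" and n
  proof -
    have "(\<Sum>y\<in>F n. g (c y)) = (\<Sum>t\<in>T. \<Sum>y\<in>{y\<in>F n. c y = t}. g (c y))"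
      by (rule sum.group[symmetric]) (use fin T in auto)
    also have "\<dots> = (\<Sum>t\<in>T. g t * card {y\<in>F n. c y = t})"
      by (intro sum.cong) auto
    finally show ?thesis by (simp add: D_def sum_divide_distrib)
  qed
  have one: "(\<Sum>s\<in>T. D n s) = 1" for n
    using sum_D[of "\<lambda>_. 1" n] fin[of n] by simp
  have diff: "(\<lambda>n. D n t - D n s) \<longlonglongrightarrow> 0" if st: "s \<in> T" "t \<in> T" for s t
  proof -
    obtain v where v: "c y = t \<longleftrightarrow> c (y + v) = s" for y using translate[OF st(2,1)] by auto
    show ?thesis
      using folner_density_shift[OF F, of "\<lambda>y. c y = s" v] unfolding v[symmetric] D_def .
  qed
  have "(\<lambda>n. D n t) \<longlonglongrightarrow> 1 / card T" if t: "t \<in> T" for t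
  proof -
    have "(\<lambda>n. (1 + (\<Sum>s\<in>T. D n t - D n s)) / card T) \<longlonglongrightarrow> (1 + (\<Sum>s\<in>T. 0)) / card T"
      using diff[OF _ t] T0 T(1) by (intro tendsto_intros) auto
    moreover have "(1 + (\<Sum>s\<in>T. D n t - D n s)) / card T = D n t" for n
      using one[of n] T0 T(1) by (simp add: sum_subtractf)
    ultimately show ?thesis by simp
  qed
  then have "(\<lambda>n. \<Sum>t\<in>T. h t * D n t) \<longlonglongrightarrow> (\<Sum>t\<in>T. h t * (1 / card T))"
    by (intro tendsto_sum tendsto_mult tendsto_const)
  then show ?thesis unfolding sum_D by (simp add: sum_divide_distrib)
qed

section \<open>The coset of a point modulo several primes\<close>

text \<open>
  The coset of \<open>- y\<close> (not of \<open>y\<close>) modulo \<open>p\<close>, since \<open>x\<close> lies in it iff \<open>p\<close> divides \<open>x + y\<close>.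
\<close>

definition neg_coset :: "int ^ 'd \<Rightarrow> nat \<Rightarrow> (int ^ 'd) set" where
  "neg_coset y p = {x. \<forall>i. int p dvd (x + y) $ i}"

lemma zero_mem_neg_coset: "0 \<in> neg_coset y p \<longleftrightarrow> (\<forall>i. int p dvd y $ i)"
  by (simp add: neg_coset_def)

lemma coset_eq_neg_coset: "(\<lambda>z. a + z) ` range (\<lambda>z :: int ^ 'd. int p *s z) = neg_coset (- a) p"
proof (intro set_eqI iffI)
  fix x assume "x \<in> neg_coset (- a) p"
  then have "\<forall>i. \<exists>k. x $ i - a $ i = int p * k" by (auto simp: neg_coset_def dvd_def)
  then obtain k where "x $ i - a $ i = int p * k i" for i by metis
  then have "x = a + int p *s (\<chi> i. k i)" by (auto simp: vec_eq_iff algebra_simps)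
  then show "x \<in> (\<lambda>z. a + z) ` range (\<lambda>z. int p *s z)" by blast
qed (auto simp: neg_coset_def)

lemma cosets_mult_eq: "cosets_mult p = range (\<lambda>y. neg_coset y p)"
  unfolding cosets_mult_def coset_eq_neg_coset
  by (auto simp: image_iff) (metis minus_minus)

lemma neg_coset_eq_iff: "neg_coset y p = neg_coset z p \<longleftrightarrow> (\<forall>i. int p dvd y $ i - z $ i)"
proof
  assume "neg_coset y p = neg_coset z p"
  moreover have "- z \<in> neg_coset z p" by (simp add: neg_coset_def)
  ultimately have "- z \<in> neg_coset y p" by simp
  then show "\<forall>i. int p dvd y $ i - z $ i" by (simp add: neg_coset_def)
next
  assume *: "\<forall>i. int p dvd y $ i - z $ i"
  have "int p dvd (x + y) $ i \<longleftrightarrow> int p dvd (x + z) $ i" for x i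
    using *[rule_format, of i] dvd_add_right_iff[of "int p" "y $ i - z $ i" "(x + z) $ i"]
    by (simp add: algebra_simps)
  then show "neg_coset y p = neg_coset z p" by (simp add: neg_coset_def)
qed

text \<open>
  The Chinese remainder theorem, applied to each coordinate.
\<close>

lemma ex_neg_coset_eq:
  fixes t :: "nat \<Rightarrow> (int ^ 'd) set"
  assumes P: "finite P" "\<And>p. p \<in> P \<Longrightarrow> prime p" and t: "\<And>p. p \<in> P \<Longrightarrow> t p \<in> cosets_mult p"
  shows "\<exists>y. \<forall>p\<in>P. neg_coset y p = t p"
proof -
  have "\<forall>p\<in>P. \<exists>a. t p = neg_coset a p" using t by (auto simp: cosets_mult_eq)
  then obtain a where a: "\<And>p. p \<in> P \<Longrightarrow> t p = neg_coset (a p) p" by metis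
  have "\<exists>x. \<forall>p\<in>P. [x = nat (a p $ i mod int p)] (mod p)" for i
    by (rule chinese_remainder_nat) (use P in \<open>auto intro: primes_coprime\<close>)
  then obtain x where x: "\<And>i p. p \<in> P \<Longrightarrow> [x i = nat (a p $ i mod int p)] (mod p)" by metis
  have "int p dvd int (x i) - a p $ i" if "p \<in> P" for p i
  proof -
    have "p > 0" using P(2)[OF that] by (simp add: prime_gt_0_nat)
    then show ?thesis
      using x[OF that, of i, folded cong_int_iff] by (simp add: cong_def mod_eq_dvd_iff)
  qed
  then show ?thesis
    by (intro exI[of _ "\<chi> i. int (x i)"]) (auto simp: a neg_coset_eq_iff)
qed

text \<open>
  If \<open>s\<close> and \<open>t\<close> are the cosets of \<open>- a\<close> and \<open>- b\<close>, the translation by \<open>b - a\<close> maps the points with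
  cosets \<open>s\<close> onto those with cosets \<open>t\<close>. So the system of cosets equidistributes.
\<close>

lemma folner_neg_cosets_uniform:
  fixes F :: "nat \<Rightarrow> (int ^ 'd) set" and h :: "(nat \<Rightarrow> (int ^ 'd) set) \<Rightarrow> real"
  assumes F: "folner_seq F" and P: "finite P" "\<And>p. p \<in> P \<Longrightarrow> prime p"
  shows "(\<lambda>n. (\<Sum>y\<in>F n. h (restrict (neg_coset y) P)) / card (F n))
    \<longlonglongrightarrow> (\<Sum>t\<in>PiE P cosets_mult. h t) / card (PiE P (cosets_mult :: _ \<Rightarrow> (int ^ 'd) set set))"
proof (rule folner_equidistributed[OF F])
  show "finite (PiE P cosets_mult :: (nat \<Rightarrow> (int ^ 'd) set) set)"
    using P by (intro finite_PiE finite_cosets_mult) (auto simp: prime_gt_0_nat)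
  show "restrict (neg_coset y) P \<in> PiE P cosets_mult" for y :: "int ^ 'd"
    by (auto simp: cosets_mult_eq)
  fix s t :: "nat \<Rightarrow> (int ^ 'd) set"
  assume st: "s \<in> PiE P cosets_mult" "t \<in> PiE P cosets_mult"
  obtain a where a: "\<And>p. p \<in> P \<Longrightarrow> s p = neg_coset a p"
    using ex_neg_coset_eq[OF P, of s] st by (metis PiE_mem)
  obtain b where b: "\<And>p. p \<in> P \<Longrightarrow> t p = neg_coset b p"
    using ex_neg_coset_eq[OF P, of t] st by (metis PiE_mem)
  have "s = restrict (neg_coset a) P" "t = restrict (neg_coset b) P"
    using st a b by (auto simp: fun_eq_iff restrict_def PiE_def extensional_def)
  moreover have "restrict (neg_coset y) P = restrict (neg_coset a) P \<longleftrightarrow>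
     restrict (neg_coset (y + (b - a))) P = restrict (neg_coset b) P" for y
    by (simp add: restrict_def fun_eq_iff neg_coset_eq_iff)
  ultimately show "\<exists>v. \<forall>y. restrict (neg_coset y) P = s \<longleftrightarrow> restrict (neg_coset (y + v)) P = t"
    by blast
qed

section \<open>Rough points\<close>

definition rough :: "nat set \<Rightarrow> int ^ 'd \<Rightarrow> bool" where
  "rough P x \<longleftrightarrow> (\<forall>p\<in>P. \<exists>i. \<not> int p dvd x $ i)"

text \<open>
  The map in the definition of \<open>mu_inf_cop\<close>, with the primes restricted to \<open>P\<close>.
\<close>

definition unsieved :: "nat set \<Rightarrow> (nat \<Rightarrow> (int ^ 'd) set) \<Rightarrow> int ^ 'd \<Rightarrow> bool" where
  "unsieved P W x \<longleftrightarrow> (\<forall>p\<in>P. x \<notin> W p)"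

lemma unsieved_neg_coset: "unsieved P (neg_coset y) = (\<lambda>x. rough P (x + y))"
  by (auto simp: unsieved_def rough_def neg_coset_def fun_eq_iff)

lemma unsieved_restrict: "unsieved P (restrict W P) = unsieved P W"
  by (simp add: unsieved_def fun_eq_iff)

lemma cop_eq_rough: "cop x = rough {p. prime p} (x :: int ^ 'd)"
proof -
  let ?g = "Gcd (range (\<lambda>i. x $ i))"
  have dvd: "int p dvd ?g \<longleftrightarrow> (\<forall>i. int p dvd x $ i)" for p
    by (simp add: dvd_Gcd_iff)
  have "?g = 1 \<longleftrightarrow> nat ?g = 1" by (simp add: nat_eq_iff)
  also have "\<dots> \<longleftrightarrow> (\<forall>p. prime p \<longrightarrow> \<not> p dvd nat ?g)"
    using prime_factor_nat[of "nat ?g"] by (metis nat_dvd_1_iff_1 not_prime_1)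
  also have "\<dots> \<longleftrightarrow> (\<forall>p. prime p \<longrightarrow> \<not> int p dvd ?g)"
    by (metis Gcd_int_greater_eq_0 int_dvd_int_iff int_nat_eq)
  finally show ?thesis by (auto simp: cop_def rough_def dvd)
qed

lemma rough_antimono: "P \<subseteq> Q \<Longrightarrow> rough Q x \<Longrightarrow> rough P x"
  by (auto simp: rough_def)

lemma integral_mu_cop:
  fixes f :: "(int ^ 'd \<Rightarrow> bool) \<Rightarrow> real"
  assumes "finite F" "F \<noteq> {}" "f \<in> borel_measurable borel"
  shows "(\<integral>\<omega>. f \<omega> \<partial>mu_cop F) = (\<Sum>y\<in>F. f (\<lambda>x. cop (x + y))) / card F"
  unfolding mu_cop_def using assms
  by (subst integral_distr) (simp_all add: integral_pmf_of_set)

lemma emeasure_mu_cop_coprime: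
  assumes "finite F" "F \<noteq> {}"
  shows "emeasure (mu_cop F) {\<omega>. \<omega> 0} = ennreal (real (card {y \<in> F. cop y}) / card F)"
  unfolding mu_cop_def using assms sets_borel_coordinate[of 0]
  by (subst emeasure_distr) (simp_all add: emeasure_pmf_of_set Int_def vimage_def)

section \<open>The random cosets\<close>

lemma measurable_unsieved:
  assumes "\<And>p. p \<in> P \<Longrightarrow> prime p"
  shows "unsieved P \<in> (random_cosets :: (nat \<Rightarrow> (int ^ 'd) set) measure) \<rightarrow>\<^sub>M borel"
proof (rule measurable_coordinatewise_then_product)
  fix x :: "int ^ 'd"
  have "(\<lambda>W. x \<in> W p) \<in> random_cosets \<rightarrow>\<^sub>M count_space UNIV" if "p \<in> P" for p
    unfolding random_cosets_def
    by (rule measurable_compose[OF measurable_component_singleton]) (use that assms in auto)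
  then have "(\<lambda>W. \<forall>p\<in>P. x \<notin> W p) \<in> random_cosets \<rightarrow>\<^sub>M count_space UNIV"
    by (intro pred_intros_countable_bounded pred_intros_logic) auto
  then show "(\<lambda>W. unsieved P W x) \<in> borel_measurable random_cosets"
    unfolding unsieved_def
    by (rule measurable_compose[OF _ borel_measurable_count_space[of "\<lambda>b. b"]])
qed

lemma prob_space_random_cosets: "prob_space random_cosets"
  unfolding random_cosets_def by (intro prob_space_PiM measure_pmf.prob_space_axioms)

text \<open>
  Finitely many of the random cosets are jointly uniform: each choice \<open>t\<close> is a cylinder event of
  probability \<open>\<Prod>p\<in>P. 1 / p\<^sup>d\<close>, and these events exhaust the space up to a null set. The measurability
  assumption concerns the values of \<open>h\<close> on this null set, at families of sets that are not cosets.
\<close>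

lemma integral_random_cosets_restrict:
  fixes h :: "(nat \<Rightarrow> (int ^ 'd) set) \<Rightarrow> real"
  assumes P: "finite P" "\<And>p. p \<in> P \<Longrightarrow> prime p"
    and meas: "(\<lambda>W. h (restrict W P)) \<in> borel_measurable random_cosets"
  shows "(\<integral>W. h (restrict W P) \<partial>random_cosets) =
    (\<Sum>t\<in>PiE P cosets_mult. h t) / card (PiE P (cosets_mult :: _ \<Rightarrow> (int ^ 'd) set set))"
proof -
  interpret R: prob_space "random_cosets :: (nat \<Rightarrow> (int ^ 'd) set) measure"
    by (rule prob_space_random_cosets)
  let ?M = "\<lambda>p. measure_pmf (pmf_of_set (cosets_mult p :: (int ^ 'd) set set))"
  let ?T = "PiE P cosets_mult :: (nat \<Rightarrow> (int ^ 'd) set) set"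
  have fin: "finite (cosets_mult p :: (int ^ 'd) set set)" if "p \<in> P" for p
    using P(2)[OF that] by (intro finite_cosets_mult) (simp add: prime_gt_0_nat)
  have finT: "finite ?T" using P fin by (intro finite_PiE) auto
  define E where "E t = {W \<in> space random_cosets. \<forall>p\<in>P. W p \<in> {t p}}" for t :: "nat \<Rightarrow> (int ^ 'd) set"
  have E_emb: "E t = prod_emb {p. prime p} ?M P (PiE P (\<lambda>p. {t p}))" for t
    using P(2) by (auto simp: E_def prod_emb_def random_cosets_def space_PiM PiE_iff extensional_def)
  have sets_E: "E t \<in> sets random_cosets" for t
    unfolding E_emb random_cosets_def using P by (intro sets_PiM_I) auto
  have prob_E: "R.prob (E t) = 1 / card ?T" if t: "t \<in> ?T" for t
  proof -
    have "emeasure random_cosets (E t) = (\<Prod>p\<in>P. emeasure (?M p) {t p})"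
      unfolding E_emb random_cosets_def using P
      by (intro emeasure_PiM_emb measure_pmf.prob_space_axioms) auto
    also have "\<dots> = (\<Prod>p\<in>P. ennreal (1 / card (cosets_mult p :: (int ^ 'd) set set)))"
      using t fin by (intro prod.cong refl)
        (auto simp: emeasure_pmf_single pmf_of_set cosets_mult_nonempty PiE_iff)
    also have "\<dots> = ennreal (1 / card ?T)"
      using P by (simp add: prod_ennreal card_PiE prod_dividef)
    finally show ?thesis by (simp add: measure_def)
  qed
  have ae: "AE W in random_cosets. \<forall>p\<in>P. W p \<in> (cosets_mult p :: (int ^ 'd) set set)"
  proof (rule AE_finite_allI[OF P(1)])
    fix p assume p: "p \<in> P"
    show "AE W in random_cosets. W p \<in> (cosets_mult p :: (int ^ 'd) set set)"
      unfolding random_cosets_def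
      by (rule AE_PiM_component)
        (use p P fin in \<open>auto simp: AE_measure_pmf_iff cosets_mult_nonempty measure_pmf.prob_space_axioms\<close>)
  qed
  have simple: "AE W in random_cosets. h (restrict W P) = (\<Sum>t\<in>?T. h t * indicator (E t) W)"
    using ae AE_space
  proof eventually_elim
    case (elim W)
    have "indicator (E t) W = (if t = restrict W P then 1 else 0 :: real)" if "t \<in> ?T" for t
    proof -
      have "t \<in> extensional P" using that by (simp add: PiE_iff)
      then have "(\<forall>p\<in>P. W p = t p) \<longleftrightarrow> t = restrict W P"
        by (metis extensionalityI restrict_apply' restrict_extensional)
      then show ?thesis using elim(2) by (simp add: E_def)
    qed
    then have "(\<Sum>t\<in>?T. h t * indicator (E t) W) = (\<Sum>t\<in>?T. if t = restrict W P then h t else 0)"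
      by (intro sum.cong) auto
    also have "\<dots> = h (restrict W P)" using elim(1) finT by (simp add: sum.delta)
    finally show ?case by simp
  qed
  have "(\<integral>W. h (restrict W P) \<partial>random_cosets) = (\<integral>W. (\<Sum>t\<in>?T. h t * indicator (E t) W) \<partial>random_cosets)"
    by (rule integral_cong_AE) (use simple meas sets_E in auto)
  also have "\<dots> = (\<Sum>t\<in>?T. h t * R.prob (E t))"
    using sets_E by (subst Bochner_Integration.integral_sum) (auto simp: R.emeasure_eq_measure)
  also have "\<dots> = (\<Sum>t\<in>?T. h t) / card ?T"
    by (simp add: prob_E sum_divide_distrib)
  finally show ?thesis .
qed

text \<open>
  For each \<open>p\<close> exactly one of the \<open>p\<^sup>d\<close> cosets contains the origin.
\<close>

lemma fraction_unsieved_zero: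
  assumes P: "finite P" "\<And>p. p \<in> P \<Longrightarrow> prime p"
  shows "(\<Sum>t\<in>PiE P cosets_mult. of_bool (unsieved P t (0 :: int ^ 'd))) / card (PiE P (cosets_mult :: _ \<Rightarrow> (int ^ 'd) set set))
    = (\<Prod>p\<in>P. 1 - 1 / real p ^ CARD('d))"
proof -
  let ?C = "cosets_mult :: nat \<Rightarrow> (int ^ 'd) set set"
  have fin: "finite (?C p)" "card (?C p) = p ^ CARD('d)" "p > 0" if "p \<in> P" for p
    using P(2)[OF that] by (auto simp: finite_cosets_mult card_cosets_mult prime_gt_0_nat)
  have finT: "finite (PiE P ?C)" using P fin by (intro finite_PiE) auto
  have "(\<Sum>t\<in>PiE P ?C. of_bool (unsieved P t 0)) = real (card {t \<in> PiE P ?C. unsieved P t 0})"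
    using finT by (simp add: of_bool_def sum.If_cases Int_def)
  also have "{t \<in> PiE P ?C. unsieved P t 0} = PiE P (\<lambda>p. ?C p - {neg_coset 0 p})"
  proof -
    have "0 \<in> c \<longleftrightarrow> c = neg_coset 0 p" if "c \<in> ?C p" for c p
    proof -
      obtain y where "c = neg_coset y p" using \<open>c \<in> ?C p\<close> unfolding cosets_mult_eq by blast
      then show ?thesis by (simp add: zero_mem_neg_coset neg_coset_eq_iff)
    qed
    then have "(\<forall>p\<in>P. t p \<in> ?C p) \<and> (\<forall>p\<in>P. 0 \<notin> t p) \<longleftrightarrow> (\<forall>p\<in>P. t p \<in> ?C p - {neg_coset 0 p})" for t
      by (metis Diff_iff singleton_iff)
    then show ?thesis unfolding unsieved_def set_eq_iff mem_Collect_eq PiE_iff by metis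
  qed
  also have "real (card \<dots>) = (\<Prod>p\<in>P. real p ^ CARD('d) - 1)"
  proof -
    have "card (?C p - {neg_coset 0 p}) = p ^ CARD('d) - 1" if "p \<in> P" for p
      using fin[OF that] by (subst card_Diff_singleton) (auto simp: cosets_mult_eq)
    then show ?thesis using P fin by (simp add: card_PiE of_nat_diff Suc_leI)
  qed
  finally have num: "(\<Sum>t\<in>PiE P ?C. of_bool (unsieved P t 0)) = (\<Prod>p\<in>P. real p ^ CARD('d) - 1)" .
  have den: "real (card (PiE P ?C)) = (\<Prod>p\<in>P. real p ^ CARD('d))"
    using P fin by (simp add: card_PiE)
  show ?thesis
    unfolding num den prod_dividef[symmetric]
    by (intro prod.cong) (use fin in \<open>auto simp: diff_divide_distrib\<close>)
qed

text \<open>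
  Both sides are governed by the same average over the choices of one coset per \<open>p \<in> P\<close>.
\<close>

lemma folner_rough_configuration:
  fixes F :: "nat \<Rightarrow> (int ^ 'd) set" and f :: "(int ^ 'd \<Rightarrow> bool) \<Rightarrow> real"
  assumes F: "folner_seq F" and P: "finite P" "\<And>p. p \<in> P \<Longrightarrow> prime p"
    and f: "f \<in> borel_measurable borel"
  shows "(\<lambda>n. (\<Sum>y\<in>F n. f (\<lambda>x. rough P (x + y))) / card (F n))
    \<longlonglongrightarrow> (\<integral>W. f (unsieved P W) \<partial>random_cosets)"
proof -
  have "(\<lambda>W. f (unsieved P W)) \<in> borel_measurable random_cosets"
    by (rule measurable_compose[OF measurable_unsieved f]) (rule P)
  then show ?thesis
    using integral_random_cosets_restrict[OF P, of "\<lambda>t. f (unsieved P t)"]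
      folner_neg_cosets_uniform[OF F P, of "\<lambda>t. f (unsieved P t)"]
    by (simp add: unsieved_restrict unsieved_neg_coset)
qed

lemma folner_rough_density:
  fixes F :: "nat \<Rightarrow> (int ^ 'd) set"
  assumes F: "folner_seq F" and P: "finite P" "\<And>p. p \<in> P \<Longrightarrow> prime p"
  shows "(\<lambda>n. real (card {y \<in> F n. rough P y}) / card (F n)) \<longlonglongrightarrow> (\<Prod>p\<in>P. 1 - 1 / real p ^ CARD('d))"
proof -
  have fin: "finite (F n)" for n using F by (auto simp: folner_seq_def)
  have "(\<Sum>y\<in>F n. of_bool (unsieved P (restrict (neg_coset y) P) 0)) = real (card {y \<in> F n. rough P y})" for n
    using fin[of n] by (simp add: unsieved_restrict unsieved_neg_coset of_bool_def sum.If_cases Int_def)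
  then show ?thesis
    using folner_neg_cosets_uniform[OF F P, of "\<lambda>t. of_bool (unsieved P t 0)"]
    by (simp add: fraction_unsieved_zero[OF P])
qed

section \<open>The Euler product\<close>

text \<open>
  Half of the Euler product. One prime at a time: writing \<open>n = p\<^sup>v m\<close> with \<open>m\<close> prime to \<open>p\<close> bounds the
  sum over \<open>B\<close> by a finite geometric sum in \<open>g p\<close> times a sum over numbers without the factor \<open>p\<close>, and
  the factor \<open>1 - g p\<close> cancels the geometric sum up to a factor of at most 1.
\<close>

lemma sum_completely_multiplicative_le:
  fixes g :: "nat \<Rightarrow> real"
  assumes mult: "\<And>m n. g (m * n) = g m * g n" and one: "g 1 = 1"
    and nonneg: "\<And>n. g n \<ge> 0" and less1: "\<And>p. p \<in> P \<Longrightarrow> g p < 1"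
    and P: "finite P" "\<And>p. p \<in> P \<Longrightarrow> prime p"
    and B: "finite B" "\<And>n. n \<in> B \<Longrightarrow> n > 0 \<and> prime_factors n \<subseteq> P"
  shows "(\<Prod>p\<in>P. 1 - g p) * (\<Sum>n\<in>B. g n) \<le> 1"
  using P(1) less1 P(2) B
proof (induction P arbitrary: B rule: finite_induct)
  case empty
  have "B \<subseteq> {1}"
    using empty.prems(4) by (auto simp: prime_factorization_empty_iff)
  then have "(\<Sum>n\<in>B. g n) \<le> (\<Sum>n\<in>{1}. g n)" by (intro sum_mono2) (auto simp: nonneg)
  then show ?case using one by simp
next
  case (insert p P)
  have p: "prime p" "g p < 1" using insert.prems by auto
  define v where "v n = multiplicity p n" for n
  define m where "m n = n div p ^ v n" for n
  have n_eq: "n = p ^ v n * m n" for n unfolding v_def m_def by (simp add: multiplicity_dvd)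
  have pow: "g (p ^ j) = g p ^ j" for j by (induction j) (use one mult in auto)
  have g_eq: "g n = g p ^ v n * g (m n)" for n using n_eq[of n] mult pow by metis
  obtain K where K: "\<And>n. n \<in> B \<Longrightarrow> v n \<le> K"
    using finite_nat_set_iff_bounded_le[of "v ` B"] insert.prems(3) by auto
  have IH: "(\<Prod>p\<in>P. 1 - g p) * (\<Sum>n\<in>m ` B. g n) \<le> 1"
  proof (rule insert.IH)
    fix n' assume "n' \<in> m ` B"
    then obtain n where n: "n \<in> B" "n' = m n" by auto
    have dvd: "m n dvd n" using n_eq[of n] by (metis dvd_triv_right)
    have n0: "n > 0" "prime_factors n \<subseteq> insert p P" using insert.prems(4) n(1) by auto
    have "m n > 0" using n_eq[of n] n0(1) by (metis mult_0_right neq0_conv)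
    moreover have "\<not> p dvd m n"
      using multiplicity_decompose[of n p] n0(1) p(1) by (simp add: m_def v_def prime_nat_iff)
    moreover have "prime_factors (m n) \<subseteq> prime_factors n"
      by (rule dvd_prime_factors) (use dvd n0(1) in auto)
    ultimately show "n' > 0 \<and> prime_factors n' \<subseteq> P" using n0(2) n(2) by auto
  qed (use insert.prems in auto)
  have nn: "(\<Prod>p\<in>P. 1 - g p) \<ge> 0"
    using insert.prems(1) by (intro prod_nonneg) (auto simp: less_imp_le)
  have inj: "inj_on (\<lambda>n. (v n, m n)) B"
  proof (rule inj_onI)
    fix a b assume "(v a, m a) = (v b, m b)"
    then have "p ^ v a * m a = p ^ v b * m b" by simp
    then show "a = b" unfolding n_eq[symmetric] .
  qed
  have "(\<Sum>n\<in>B. g n) = (\<Sum>(j, k)\<in>(\<lambda>n. (v n, m n)) ` B. g p ^ j * g k)"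
    by (simp add: sum.reindex[OF inj] flip: g_eq)
  also have "\<dots> \<le> (\<Sum>(j, k)\<in>{..K} \<times> m ` B. g p ^ j * g k)"
    using K insert.prems(3) by (intro sum_mono2) (auto simp: nonneg)
  also have "\<dots> = (\<Sum>j\<le>K. g p ^ j) * (\<Sum>k\<in>m ` B. g k)"
    by (simp add: sum_product sum.cartesian_product)
  finally have "(1 - g p) * (\<Sum>n\<in>B. g n) \<le> (1 - g p) * (\<Sum>j\<le>K. g p ^ j) * (\<Sum>k\<in>m ` B. g k)"
    using p(2) by (simp add: mult_left_mono mult.assoc)
  also have "(1 - g p) * (\<Sum>j\<le>K. g p ^ j) = 1 - g p ^ Suc K"
    using sum_gp_basic[of "g p" K] by simp
  also have "(1 - g p ^ Suc K) * (\<Sum>k\<in>m ` B. g k) \<le> 1 * (\<Sum>k\<in>m ` B. g k)"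
    by (intro mult_right_mono sum_nonneg) (simp_all add: nonneg)
  finally have "(\<Prod>p\<in>P. 1 - g p) * ((1 - g p) * (\<Sum>n\<in>B. g n)) \<le> (\<Prod>p\<in>P. 1 - g p) * (\<Sum>k\<in>m ` B. g k)"
    using nn by (simp add: mult_left_mono)
  then show ?case using IH insert.hyps by (simp add: mult_ac)
qed

definition primes_upto :: "nat \<Rightarrow> nat set" where
  "primes_upto k = {p. prime p \<and> p \<le> k}"

lemma finite_primes_upto [simp]: "finite (primes_upto k)"
  by (simp add: primes_upto_def)

lemma primes_uptoD: "p \<in> primes_upto k \<Longrightarrow> prime p"
  by (simp add: primes_upto_def)

text \<open>
  All \<open>n \<le> k\<close> have only prime factors up to \<open>k\<close>, so the product is at most the reciprocal of the
  \<open>k\<close>-th partial sum of the zeta series. Inversion is continuous on \<open>ennreal\<close> even at \<open>\<infinity>\<close>, so the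
  divergent case \<open>d = 1\<close> is not special.
\<close>

lemma prod_primes_upto_le_zeta:
  assumes d: "d \<ge> 1" and L: "L \<ge> 0" "ennreal L = 1 / zeta (real d)" and e: "e > 0"
  shows "\<forall>\<^sub>F k in sequentially. (\<Prod>p\<in>primes_upto k. 1 - 1 / real p ^ d) < L + e"
proof -
  define S where "S k = (\<Sum>n<k. real (Suc n) powr - real d)" for k
  have S0: "S k \<ge> 0" for k by (auto simp: S_def intro!: sum_nonneg)
  have S1: "S k > 0" if "k \<ge> 1" for k unfolding S_def by (rule sum_pos) (use that in \<open>auto simp: lessThan_empty_iff\<close>)
  have "(\<lambda>k. \<Sum>n<k. ennreal (real (Suc n) powr - real d)) \<longlonglongrightarrow> zeta (real d)"
    unfolding zeta_def by (rule summable_LIMSEQ) simp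
  then have "(\<lambda>k. ennreal (S k)) \<longlonglongrightarrow> zeta (real d)"
    by (simp add: S_def sum_ennreal)
  then have "(\<lambda>k. 1 / ennreal (S k)) \<longlonglongrightarrow> 1 / zeta (real d)"
    using continuous_on_tendsto_compose[OF continuous_on_inverse_ennreal[OF continuous_on_id],
        of _ "zeta (real d)" sequentially UNIV]
    by (simp add: divide_ennreal_def)
  moreover have "\<forall>\<^sub>F k in sequentially. 1 / ennreal (S k) = ennreal (1 / S k)"
    using eventually_ge_at_top[of 1]
    by eventually_elim (use S1 in \<open>simp add: divide_ennreal flip: ennreal_1\<close>)
  ultimately have "(\<lambda>k. ennreal (1 / S k)) \<longlonglongrightarrow> ennreal L"
    unfolding L(2) by (rule Lim_transform_eventually)
  then have "(\<lambda>k. 1 / S k) \<longlonglongrightarrow> L" using L(1) S0 by (subst (asm) tendsto_ennreal_iff) auto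
  then have "\<forall>\<^sub>F k in sequentially. 1 / S k < L + e"
    by (rule order_tendstoD) (use e in simp)
  then show ?thesis using eventually_ge_at_top[of 1]
  proof eventually_elim
    case (elim k)
    let ?g = "\<lambda>n. 1 / real n ^ d"
    have "(\<Prod>p\<in>primes_upto k. 1 - ?g p) * (\<Sum>n\<in>{1..k}. ?g n) \<le> 1"
    proof (rule sum_completely_multiplicative_le)
      show "?g p < 1" if "p \<in> primes_upto k" for p
        using that d by (auto simp: primes_upto_def intro!: one_less_power dest: prime_gt_1_nat)
      show "n > 0 \<and> prime_factors n \<subseteq> primes_upto k" if "n \<in> {1..k}" for n
        using that by (auto simp: primes_upto_def in_prime_factors_iff intro: order_trans[OF dvd_imp_le])
    qed (auto simp: primes_upto_def power_mult_distrib)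
    also have "(\<Sum>n\<in>{1..k}. ?g n) = S k"
      unfolding S_def
      by (rule sum.reindex_bij_witness[of _ Suc "\<lambda>n. n - 1"])
         (auto simp: powr_minus powr_realpow field_simps)
    finally have "(\<Prod>p\<in>primes_upto k. 1 - ?g p) \<le> 1 / S k"
      using S1[OF elim(2)] by (simp add: field_simps)
    then show ?case using elim(1) by linarith
  qed
qed

section \<open>Continuous functions of a configuration\<close>

text \<open>
  By Tychonoff's theorem the configuration space is compact. Around each configuration \<open>\<omega>\<close> there is a
  cylinder set on which \<open>f\<close> stays within \<open>e / 2\<close> of \<open>f \<omega>\<close>; finitely many of these cover the space, and
  their coordinates together suffice.
\<close>

lemma continuous_finitely_many_coordinates:
  fixes f :: "('a \<Rightarrow> bool) \<Rightarrow> 'b :: metric_space"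
  assumes f: "continuous_on UNIV f" and e: "e > 0"
  shows "\<exists>A. finite A \<and> (\<forall>\<omega> \<omega>'. (\<forall>x\<in>A. \<omega> x = \<omega>' x) \<longrightarrow> dist (f \<omega>) (f \<omega>') < e)"
proof -
  have "compact_space (product_topology (\<lambda>_. euclidean) UNIV :: ('a \<Rightarrow> bool) topology)"
    unfolding compact_space_product_topology
    by (simp add: compact_space_def compactin_euclidean_iff finite_imp_compact)
  then have cpt: "compact (UNIV :: ('a \<Rightarrow> bool) set)"
    by (simp add: compact_space_def euclidean_product_topology compactin_euclidean_iff)
  define U where "U A \<omega> = {\<omega>' :: 'a \<Rightarrow> bool. \<forall>x\<in>A. \<omega>' x = \<omega> x}" for A \<omega>
  have "\<exists>A. finite A \<and> (\<forall>\<omega>'\<in>U A \<omega>. dist (f \<omega>) (f \<omega>') < e / 2)" for \<omega>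
  proof -
    let ?V = "f -` ball (f \<omega>) (e / 2)"
    have "openin (product_topology (\<lambda>_. euclidean) UNIV) ?V"
      using open_vimage[OF open_ball f] by (simp add: open_fun_def)
    moreover have "\<omega> \<in> ?V" using e by simp
    ultimately obtain X where X: "\<omega> \<in> PiE UNIV X" "finite {i. X i \<noteq> UNIV}" "PiE UNIV X \<subseteq> ?V"
      by (drule_tac product_topology_open_contains_basis[of _ _ ?V \<omega>]) auto
    have "\<omega>' \<in> PiE UNIV X" if "\<omega>' \<in> U {i. X i \<noteq> UNIV} \<omega>" for \<omega>'
    proof -
      have "\<omega>' i \<in> X i" for i
        by (cases "X i = UNIV") (use that X(1) in \<open>auto simp: U_def PiE_iff\<close>)
      then show ?thesis by auto
    qed
    then have "dist (f \<omega>) (f \<omega>') < e / 2" if "\<omega>' \<in> U {i. X i \<noteq> UNIV} \<omega>" for \<omega>'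
      using X(3) that by (auto simp: subset_iff)
    then show ?thesis using X(2) by blast
  qed
  then obtain A where A: "\<And>\<omega>. finite (A \<omega>)" "\<And>\<omega> \<omega>'. \<omega>' \<in> U (A \<omega>) \<omega> \<Longrightarrow> dist (f \<omega>) (f \<omega>') < e / 2"
    by metis
  have "open (U (A \<omega>) \<omega>)" for \<omega>
  proof -
    have "open ((\<lambda>\<omega>' :: 'a \<Rightarrow> bool. \<omega>' x) -` {\<omega> x})" for x
      by (intro open_vimage continuous_on_product_coordinates Topological_Spaces.open_discrete)
    then have "open (\<Inter>x\<in>A \<omega>. (\<lambda>\<omega>' :: 'a \<Rightarrow> bool. \<omega>' x) -` {\<omega> x})"
      using A(1) by (intro open_INT) auto
    then show ?thesis by (simp add: U_def vimage_def INTER_eq)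
  qed
  then obtain C where C: "finite C" "UNIV \<subseteq> (\<Union>\<omega>\<in>C. U (A \<omega>) \<omega>)"
    by (rule_tac compactE_image[OF cpt, of UNIV "\<lambda>\<omega>. U (A \<omega>) \<omega>"]) (auto simp: U_def)
  show ?thesis
  proof (intro exI[of _ "\<Union>\<omega>\<in>C. A \<omega>"] conjI allI impI)
    show "finite (\<Union>\<omega>\<in>C. A \<omega>)" using C A by auto
    fix \<omega> \<omega>' :: "'a \<Rightarrow> bool"
    assume eq: "\<forall>x\<in>\<Union>\<omega>\<in>C. A \<omega>. \<omega> x = \<omega>' x"
    obtain \<eta> where \<eta>: "\<eta> \<in> C" "\<omega> \<in> U (A \<eta>) \<eta>" using C(2) by auto
    then have "\<omega>' \<in> U (A \<eta>) \<eta>" using eq by (auto simp: U_def)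
    then show "dist (f \<omega>) (f \<omega>') < e"
      using A(2) \<eta>(2) by (metis dist_commute dist_triangle_half_r)
  qed
qed

text \<open>
  For every \<open>W\<close> each coordinate of the sieved configuration is eventually constant in \<open>k\<close>, so \<open>f\<close> of it
  converges, and \<open>f\<close> is bounded.
\<close>

lemma integral_unsieved_tendsto:
  fixes f :: "(int ^ 'd \<Rightarrow> bool) \<Rightarrow> real"
  assumes f: "continuous_on UNIV f" and bound: "\<And>\<omega>. \<bar>f \<omega>\<bar> \<le> M"
  shows "(\<lambda>k. \<integral>W. f (unsieved (primes_upto k) W) \<partial>random_cosets) \<longlonglongrightarrow> (\<integral>\<omega>. f \<omega> \<partial>mu_inf_cop)"
proof -
  interpret R: prob_space "random_cosets :: (nat \<Rightarrow> (int ^ 'd) set) measure"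
    by (rule prob_space_random_cosets)
  have fm: "f \<in> borel_measurable borel" using f by (rule borel_measurable_continuous_onI)
  have meas: "(\<lambda>W. f (unsieved P W)) \<in> borel_measurable random_cosets" if "\<And>p. p \<in> P \<Longrightarrow> prime p" for P
    by (rule measurable_compose[OF measurable_unsieved fm]) (rule that)
  have "(\<lambda>k. f (unsieved (primes_upto k) W)) \<longlonglongrightarrow> f (unsieved {p. prime p} W)" for W
  proof (rule tendstoI)
    fix e :: real assume "e > 0"
    then obtain A where A: "finite A"
      "\<And>\<omega> \<omega>'. (\<forall>x\<in>A. \<omega> x = \<omega>' x) \<Longrightarrow> dist (f \<omega>) (f \<omega>') < e"
      using continuous_finitely_many_coordinates[OF f] by metis
    have "\<forall>\<^sub>F k in sequentially. unsieved (primes_upto k) W x = unsieved {p. prime p} W x" for x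
    proof (cases "unsieved {p. prime p} W x")
      case True
      then show ?thesis by (auto simp: unsieved_def primes_upto_def)
    next
      case False
      then obtain p where "prime p" "x \<in> W p" by (auto simp: unsieved_def)
      from eventually_ge_at_top[of p] show ?thesis
        by eventually_elim (use False \<open>prime p\<close> \<open>x \<in> W p\<close> in \<open>auto simp: unsieved_def primes_upto_def\<close>)
    qed
    then have "\<forall>\<^sub>F k in sequentially. \<forall>x\<in>A. unsieved (primes_upto k) W x = unsieved {p. prime p} W x"
      using A(1) by (intro eventually_ball_finite) auto
    then show "\<forall>\<^sub>F k in sequentially. dist (f (unsieved (primes_upto k) W)) (f (unsieved {p. prime p} W)) < e"
      by eventually_elim (rule A(2))
  qed
  then have "(\<lambda>k. \<integral>W. f (unsieved (primes_upto k) W) \<partial>random_cosets)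
      \<longlonglongrightarrow> (\<integral>W. f (unsieved {p. prime p} W) \<partial>random_cosets)"
    by (intro integral_dominated_convergence[where w = "\<lambda>_. M"])
      (auto intro!: meas simp: bound dest: primes_uptoD)
  also have "(\<integral>W. f (unsieved {p. prime p} W) \<partial>random_cosets) = (\<integral>\<omega>. f \<omega> \<partial>mu_inf_cop)"
  proof -
    have "(\<lambda>W x. x \<notin> (\<Union>p\<in>{p. prime p}. W p)) = (unsieved {p. prime p} :: (nat \<Rightarrow> (int ^ 'd) set) \<Rightarrow> _)"
      by (simp add: unsieved_def fun_eq_iff)
    moreover have "unsieved {p. prime p} \<in> (random_cosets :: (nat \<Rightarrow> (int ^ 'd) set) measure) \<rightarrow>\<^sub>M borel"
      by (rule measurable_unsieved) simp
    ultimately show ?thesis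
      unfolding mu_inf_cop_def using integral_distr[of "unsieved {p. prime p}" random_cosets borel f] fm
      by (simp only:)
  qed
  finally show ?thesis .
qed

section \<open>Weak convergence\<close>

theorem proposition2p3:
  fixes F :: "nat \<Rightarrow> (int ^ 'd) set"
  assumes "folner_seq F"
    and "(\<lambda>n. emeasure (mu_cop (F n)) {\<omega>. \<omega> 0}) \<longlonglongrightarrow> 1 / zeta (real CARD('d))"
  shows "weakly_converges (\<lambda>n. mu_cop (F n)) mu_inf_cop"
  unfolding weakly_converges_def
proof (intro allI impI)
  fix f :: "(int ^ 'd \<Rightarrow> bool) \<Rightarrow> real"
  assume f: "continuous_on UNIV f" and "bounded (range f)"
  then obtain M where M: "M > 0" "\<And>\<omega>. \<bar>f \<omega>\<bar> \<le> M" by (auto simp: bounded_pos)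
  have fm: "f \<in> borel_measurable borel" using f by (rule borel_measurable_continuous_onI)
  have fin: "finite (F n)" "F n \<noteq> {}" "card (F n) > 0" for n
    using assms(1) by (auto simp: folner_seq_def card_gt_0_iff)

  define L where "L = enn2real (1 / zeta (real CARD('d)))"
  \<comment> \<open>Only \<open>\<zeta>(d) = 0\<close> could make the limit infinite, and the first term of the series is 1.\<close>
  have "zeta (real CARD('d)) \<noteq> 0"
  proof -
    have "(\<Sum>n\<in>{0}. ennreal (real (Suc n) powr - real CARD('d))) \<le> zeta (real CARD('d))"
      unfolding zeta_def by (rule sum_le_suminf) auto
    then show ?thesis by auto
  qed
  then have "1 / zeta (real CARD('d)) \<noteq> top" by (simp add: ennreal_divide_eq_top_iff)
  then have L: "L \<ge> 0" "ennreal L = 1 / zeta (real CARD('d))"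
    unfolding L_def by (simp_all only: enn2real_nonneg ennreal_enn2real less_top)
  have cop: "(\<lambda>n. real (card {y \<in> F n. cop y}) / card (F n)) \<longlonglongrightarrow> L"
    using assms(2) L(1) unfolding emeasure_mu_cop_coprime[OF fin(1,2)] L(2)[symmetric]
    by (subst (asm) tendsto_ennreal_iff) auto

  define \<pi> where "\<pi> k = (\<Prod>p\<in>primes_upto k. 1 - 1 / real p ^ CARD('d))" for k
  \<comment> \<open>The non-coprime points that the sieve by the primes up to \<open>k\<close> fails to remove.\<close>
  define E where "E k y \<longleftrightarrow> rough (primes_upto k) y \<and> \<not> cop y" for k and y :: "int ^ 'd"
  have cop_rough: "cop y \<Longrightarrow> rough (primes_upto k) y" for k and y :: "int ^ 'd"
    unfolding cop_eq_rough by (erule rough_antimono[rotated]) (auto simp: primes_upto_def)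
  have E0: "(\<lambda>n. real (card {y \<in> F n. E k y}) / card (F n)) \<longlonglongrightarrow> \<pi> k - L" for k
  proof -
    have "real (card {y \<in> F n. E k y}) = card {y \<in> F n. rough (primes_upto k) y} - real (card {y \<in> F n. cop y})" for n
    proof -
      have "{y \<in> F n. E k y} = {y \<in> F n. rough (primes_upto k) y} - {y \<in> F n. cop y}"
        by (auto simp: E_def)
      moreover have "{y \<in> F n. cop y} \<subseteq> {y \<in> F n. rough (primes_upto k) y}"
        using cop_rough by auto
      ultimately show ?thesis
        using fin(1)[of n] by (simp add: card_Diff_subset of_nat_diff card_mono)
    qed
    then show ?thesis
      using tendsto_diff[OF folner_rough_density[OF assms(1) finite_primes_upto primes_uptoD, of k] cop]
      by (simp add: \<pi>_def diff_divide_distrib)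
  qed
  have E: "(\<lambda>n. real (card {y \<in> F n. E k (y + x)}) / card (F n)) \<longlonglongrightarrow> \<pi> k - L" for k x
    using tendsto_add[OF folner_density_shift[OF assms(1), of "E k" x] E0[of k]] by simp

  show "(\<lambda>n. \<integral>\<omega>. f \<omega> \<partial>mu_cop (F n)) \<longlonglongrightarrow> (\<integral>\<omega>. f \<omega> \<partial>mu_inf_cop)"
    unfolding integral_mu_cop[OF fin(1,2) fm]
  proof (rule tendstoI)
    fix e :: real assume e: "e > 0"
    then obtain A where A: "finite A"
      "\<And>\<omega> \<omega>'. (\<forall>x\<in>A. \<omega> x = \<omega>' x) \<Longrightarrow> dist (f \<omega>) (f \<omega>') < e / 4"
      using continuous_finitely_many_coordinates[OF f, of "e / 4"] by auto
    \<comment> \<open>The error budget is \<open>4 * (e / 4)\<close>: for \<open>f\<close> off the coordinates \<open>A\<close>, for the union bound, for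
      \<open>n \<rightarrow> \<infinity>\<close> with \<open>k\<close> fixed, and for \<open>k \<rightarrow> \<infinity>\<close>. The union bound costs \<open>2 * M * card A * \<delta>\<close>;
      \<open>card A + 1\<close> replaces \<open>card A\<close> to allow \<open>A = {}\<close>.\<close>
    define N where "N = real (card A) + 1"
    define \<delta> where "\<delta> = e / (8 * M * N)"
    have N: "N > 0" by (simp add: N_def)
    have \<delta>: "\<delta> > 0" using e M N by (simp add: \<delta>_def)
    let ?J = "\<lambda>k. \<integral>W. f (unsieved (primes_upto k) W) \<partial>random_cosets"
    have "\<forall>\<^sub>F k in sequentially. dist (?J k) (\<integral>\<omega>. f \<omega> \<partial>mu_inf_cop) < e / 4 \<and> \<pi> k < L + \<delta>"
      unfolding \<pi>_def using e M(2) \<delta> L f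
      by (intro eventually_conj tendstoD[OF integral_unsieved_tendsto] prod_primes_upto_le_zeta)
        (auto simp: Suc_leI)
    then obtain k where k: "dist (?J k) (\<integral>\<omega>. f \<omega> \<partial>mu_inf_cop) < e / 4" "\<pi> k < L + \<delta>"
      by (auto dest: eventually_happens)
    let ?D = "\<lambda>x n. real (card {y \<in> F n. E k (y + x)}) / card (F n)"
    let ?S = "\<lambda>n. (\<Sum>y\<in>F n. f (\<lambda>x. cop (x + y))) / card (F n)"
    let ?R = "\<lambda>n. (\<Sum>y\<in>F n. f (\<lambda>x. rough (primes_upto k) (x + y))) / card (F n)"
    have approx: "dist (?S n) (?R n) \<le> e / 4 + 2 * M * (\<Sum>x\<in>A. ?D x n)" for n
    proof -
      have pointwise: "\<bar>f (\<lambda>x. cop (x + y)) - f (\<lambda>x. rough (primes_upto k) (x + y))\<bar>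
          \<le> e / 4 + 2 * M * (\<Sum>x\<in>A. of_bool (E k (y + x)))" for y
      proof (cases "\<exists>x\<in>A. E k (y + x)")
        case False
        then have "\<forall>x\<in>A. cop (x + y) = rough (primes_upto k) (x + y)"
          using cop_rough by (auto simp: E_def add.commute)
        then show ?thesis using A(2) False by (force simp: dist_real_def less_imp_le)
      next
        case True
        then obtain x where x: "x \<in> A" "E k (y + x)" by auto
        then have "1 \<le> (\<Sum>x\<in>A. of_bool (E k (y + x)) :: real)"
          using member_le_sum[of x A "\<lambda>x. of_bool (E k (y + x)) :: real"] A(1) by simp
        then have "2 * M * 1 \<le> 2 * M * (\<Sum>x\<in>A. of_bool (E k (y + x)))"
          using M(1) by (intro mult_left_mono) auto
        then show ?thesis
          using M(2)[of "\<lambda>x. cop (x + y)"] M(2)[of "\<lambda>x. rough (primes_upto k) (x + y)"] e by linarith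
      qed
      have "dist (?S n) (?R n) = \<bar>\<Sum>y\<in>F n. f (\<lambda>x. cop (x + y)) - f (\<lambda>x. rough (primes_upto k) (x + y))\<bar> / card (F n)"
        by (simp add: dist_real_def sum_subtractf diff_divide_distrib[symmetric])
      also have "\<dots> \<le> (\<Sum>y\<in>F n. e / 4 + 2 * M * (\<Sum>x\<in>A. of_bool (E k (y + x)))) / card (F n)"
        by (intro divide_right_mono order_trans[OF sum_abs] sum_mono pointwise) auto
      also have "\<dots> = e / 4 + 2 * M * ((\<Sum>y\<in>F n. \<Sum>x\<in>A. of_bool (E k (y + x))) / card (F n))"
        using fin(3)[of n] by (simp add: sum.distrib sum_distrib_left[symmetric] add_divide_distrib)
      also have "(\<Sum>y\<in>F n. \<Sum>x\<in>A. of_bool (E k (y + x))) = (\<Sum>x\<in>A. real (card {y \<in> F n. E k (y + x)}))"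
        by (subst sum.swap) (use fin(1)[of n] in \<open>simp add: of_bool_def sum.If_cases Int_def\<close>)
      finally show ?thesis by (simp add: sum_divide_distrib)
    qed
    have "(\<lambda>n. 2 * M * (\<Sum>x\<in>A. ?D x n)) \<longlonglongrightarrow> 2 * M * (\<Sum>x\<in>A. \<pi> k - L)"
      by (intro tendsto_intros E)
    moreover have "2 * M * (\<Sum>x\<in>A. \<pi> k - L) < e / 4"
    proof -
      have "2 * M * (\<Sum>x\<in>A. \<pi> k - L) \<le> 2 * M * (card A * \<delta>)"
        using k(2) M(1) by (intro mult_left_mono) (auto intro!: mult_left_mono)
      also have "\<dots> < 2 * M * (N * \<delta>)" using M(1) \<delta> by (simp add: N_def)
      also have "\<dots> = e / 4" using M(1) N by (simp add: \<delta>_def field_simps)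
      finally show ?thesis .
    qed
    ultimately have "\<forall>\<^sub>F n in sequentially. 2 * M * (\<Sum>x\<in>A. ?D x n) < e / 4"
      by (rule order_tendstoD)
    moreover have "\<forall>\<^sub>F n in sequentially. dist (?R n) (?J k) < e / 4"
      using e by (intro tendstoD[OF folner_rough_configuration] assms(1) fm) (auto dest: primes_uptoD)
    ultimately show "\<forall>\<^sub>F n in sequentially. dist (?S n) (\<integral>\<omega>. f \<omega> \<partial>mu_inf_cop) < e"
    proof eventually_elim
      case (elim n)
      then show ?case using approx[of n] k(1)
        dist_triangle[of "?S n" "\<integral>\<omega>. f \<omega> \<partial>mu_inf_cop" "?R n"]
        dist_triangle[of "?R n" "\<integral>\<omega>. f \<omega> \<partial>mu_inf_cop" "?J k"] by linarith
    qed
  qed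
qed

end
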